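(* There exists a real number $c>0$ with the following property. For all $q\in\mathbb{Z}^+$ and all $g\in\mathbb{Z}^2$, if $\mathcal{N}(q(1/\beta,1/\beta^2)-g)<c$, then $$q(1/\beta,1/\beta^2)-g=\delta(q)\quad\text{or}\quad q(1/\beta,1/\beta^2)-g=\delta(q)-(1,1).$$
   Context: Let $a,b$ be integers with $-a+1\le b\le -2$, let $\beta$ be the real dominant root of $x^3-ax^2-bx-1$, and assume its conjugates $\alpha,\overline\alpha$ are non-real. Let $T_0=1$, $T_1=a$, $T_2=a^2+b$, $T_{n+3}=aT_{n+2}+bT_{n+1}+T_n$. Each $q\in\mathbb{Z}^+$ has a unique $T$-representation $q=\sum_{j=0}^{k}d_jT_j$ with $d_j\in\{0,\dots,a-1\}$, where every block satisfies $d_jd_{j-1}\cdots d_{j-m}\le_{\mathrm{lex}}(a-1)(a+b-1)(a+b)\cdots(a+b)$ (same length). For such $q$ we write $\delta(q)=q(1/\beta,1/\beta^2)-(\sum_{j\ge1}d_jT_{j-1},\sum_{j\ge2}d_jT_{j-2})$. The Rauzy norm is $\mathcal{N}(x_1,x_2)=|(\alpha+b/\beta)x_1+x_2/\beta|$. Standing assumption of the paper: the Rauzy fractal $\mathcal{R}=\{\sum_{i\ge2}d_i\alpha^i:(d_i)_{i\ge2}\text{ admissible}\}$ has exactly 6 neighbours. A neighbour is a nonzero translation vector $u$ of the associated lattice tiling with $\mathcal{R}\cap(\mathcal{R}+u)\neq\emptyset$. *)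

theory Defs
  imports "HOL-Analysis.Analysis"
begin

fun T :: "int \<Rightarrow> int \<Rightarrow> nat \<Rightarrow> int" where
  "T a b 0 = 1"
| "T a b (Suc 0) = a"
| "T a b (Suc (Suc 0)) = a ^ 2 + b"
| "T a b (Suc (Suc (Suc n))) = a * T a b (Suc (Suc n)) + b * T a b (Suc n) + T a b n"

definition wmax :: "int \<Rightarrow> int \<Rightarrow> nat \<Rightarrow> int" where
  "wmax a b i = (if i = 0 then a - 1 else if i = 1 then a + b - 1 else a + b)"

text \<open>Lexicographic order (non-strict) on words, used for words of equal length.\<close>
definition lex_le :: "int list \<Rightarrow> int list \<Rightarrow> bool" where
  "lex_le xs ys \<longleftrightarrow> xs = ys \<or>
     (\<exists>i < length xs. take i xs = take i ys \<and> xs ! i < ys ! i)"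

definition block :: "(nat \<Rightarrow> int) \<Rightarrow> nat \<Rightarrow> nat \<Rightarrow> int list" where
  "block d j m = map (\<lambda>i. d (j - i)) [0..<Suc m]"

definition blocks_ok :: "int \<Rightarrow> int \<Rightarrow> nat \<Rightarrow> (nat \<Rightarrow> int) \<Rightarrow> bool" where
  "blocks_ok a b lo d \<longleftrightarrow>
     (\<forall>j m. lo + m \<le> j \<longrightarrow> lex_le (block d j m) (map (wmax a b) [0..<Suc m]))"

definition is_Trep :: "int \<Rightarrow> int \<Rightarrow> int \<Rightarrow> (nat \<Rightarrow> int) \<Rightarrow> bool" where
  "is_Trep a b q d \<longleftrightarrow>
     (\<forall>j. 0 \<le> d j \<and> d j \<le> a - 1) \<and>
     (\<exists>k. (\<forall>j>k. d j = 0) \<and> q = (\<Sum>j\<le>k. d j * T a b j)) \<and>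
     blocks_ok a b 0 d"

definition Trep :: "int \<Rightarrow> int \<Rightarrow> int \<Rightarrow> (nat \<Rightarrow> int)" where
  "Trep a b q = (THE d. is_Trep a b q d)"

definition delta :: "int \<Rightarrow> int \<Rightarrow> real \<Rightarrow> int \<Rightarrow> real \<times> real" where
  "delta a b \<beta> q =
     (let d = Trep a b q in
       (real_of_int q / \<beta> - real_of_int (\<Sum>j\<in>{j. 1 \<le> j \<and> d j \<noteq> 0}. d j * T a b (j - 1)),
        real_of_int q / \<beta> ^ 2 - real_of_int (\<Sum>j\<in>{j. 2 \<le> j \<and> d j \<noteq> 0}. d j * T a b (j - 2))))"

definition rauzy_norm :: "int \<Rightarrow> real \<Rightarrow> complex \<Rightarrow> real \<times> real \<Rightarrow> real" where
  "rauzy_norm b \<beta> \<alpha> x =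
     cmod ((\<alpha> + complex_of_real (real_of_int b / \<beta>)) * complex_of_real (fst x)
           + complex_of_real (snd x / \<beta>))"

definition admissible_inf :: "int \<Rightarrow> int \<Rightarrow> (nat \<Rightarrow> int) \<Rightarrow> bool" where
  "admissible_inf a b d \<longleftrightarrow> (\<forall>i\<ge>2. 0 \<le> d i \<and> d i \<le> a - 1) \<and> blocks_ok a b 2 d"

definition rauzy_fractal :: "int \<Rightarrow> int \<Rightarrow> complex \<Rightarrow> complex set" where
  "rauzy_fractal a b \<alpha> =
     {z. \<exists>d. admissible_inf a b d \<and> z = (\<Sum>i. of_int (d (i + 2)) * \<alpha> ^ (i + 2))}"

text \<open>The lattice Z + Z alpha of the periodic tiling of C by translates of R.\<close>
definition tiling_lattice :: "complex \<Rightarrow> complex set" where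
  "tiling_lattice \<alpha> = {of_int m + of_int n * \<alpha> | m n :: int. True}"

definition neighbours :: "int \<Rightarrow> int \<Rightarrow> complex \<Rightarrow> complex set" where
  "neighbours a b \<alpha> =
     {u \<in> tiling_lattice \<alpha>. u \<noteq> 0 \<and>
        rauzy_fractal a b \<alpha> \<inter> ((\<lambda>z. z + u) ` rauzy_fractal a b \<alpha>) \<noteq> {}}"

end

theory Submission
  imports Defs
begin

text \<open>
  Up to the factor \<open>\<beta> |\<alpha>|\<close>, the norm of \<open>q (1/\<beta>, 1/\<beta>\<^sup>2) - g\<close> is the distance from the point
  \<open>\<Sum> d\<^sub>j \<alpha>\<^bsup>j+2\<^esup>\<close> of the Rauzy fractal \<open>R\<close>, where \<open>d\<close> is the \<open>T\<close>-representation of \<open>q\<close>, to a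
  point of the lattice \<open>\<int> + \<int>\<alpha>\<close>. As \<open>R\<close> is compact and the lattice is discrete, a small
  distance forces that lattice point to lie in \<open>R\<close>, so it suffices that \<open>0\<close> and
  \<open>u = -1 - (1+b)\<alpha>\<close> are the only lattice points of \<open>R\<close>.

  Explicit expansions show that \<open>\<plusminus>u\<close>, \<open>\<plusminus>\<alpha>\<close> and \<open>\<plusminus>(-1 - b\<alpha>)\<close> are always neighbours; if there
  are exactly six neighbours, these are all of them. Any nonzero lattice point \<open>x\<close> of \<open>R\<close> is a
  neighbour, and so is \<open>u - x\<close> unless \<open>x = u\<close>; this leaves \<open>u\<close>, \<open>-\<alpha>\<close> and \<open>-1 - b\<alpha>\<close>.
  The last two are excluded since removing one or two leading digits of their expansions would
  give a forbidden lattice point of \<open>R\<close>.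
\<close>

section \<open>Lexicographic order and the block condition, freed from lists\<close>

lemma lex_le_map_iff:
  "lex_le (map f [0..<n]) (map g [0..<n]) \<longleftrightarrow>
     (\<forall>m<n. (\<forall>i<m. f i = g i) \<longrightarrow> f m \<le> g m)"
proof
  have tk: "take i (map f [0..<n]) = take i (map g [0..<n]) \<longleftrightarrow> (\<forall>k<i. f k = g k)" if "i \<le> n" for i
    using that by (auto simp: take_map list_eq_iff_nth_eq)
  {
    assume "lex_le (map f [0..<n]) (map g [0..<n])"
    then consider "\<forall>i<n. f i = g i" | i where "i < n" "\<forall>k<i. f k = g k" "f i < g i"
      by (auto simp: lex_le_def tk)
    then show "\<forall>m<n. (\<forall>i<m. f i = g i) \<longrightarrow> f m \<le> g m"
    proof cases
      case 1
      then show ?thesis by simp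
    next
      case 2
      then show ?thesis by (metis less_le_not_le linorder_le_cases nless_le)
    qed
  next
    assume *: "\<forall>m<n. (\<forall>i<m. f i = g i) \<longrightarrow> f m \<le> g m"
    show "lex_le (map f [0..<n]) (map g [0..<n])"
    proof (cases "\<forall>i<n. f i = g i")
      case True
      then show ?thesis by (auto simp: lex_le_def)
    next
      case False
      then obtain i where "i < n" "f i \<noteq> g i" "\<forall>k<i. \<not> (k < n \<and> f k \<noteq> g k)"
        using exists_least_iff[of "\<lambda>i. i < n \<and> f i \<noteq> g i"] by blast
      then have i: "i < n" "f i \<noteq> g i" "\<forall>k<i. f k = g k" by auto
      with * have "f i < g i" by (metis order_le_less)
      with i show ?thesis by (auto simp: lex_le_def tk)
    qed
  }
qed

text \<open>Testing the last digit of every block suffices: a comparison at an earlier position of a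
  block is the last comparison of a shorter block with the same leading index.\<close>

lemma blocks_ok_iff:
  "blocks_ok a b lo d \<longleftrightarrow>
     (\<forall>j m. lo + m \<le> j \<longrightarrow> (\<forall>i<m. d (j - i) = wmax a b i) \<longrightarrow> d (j - m) \<le> wmax a b m)"
  unfolding blocks_ok_def block_def lex_le_map_iff
proof (intro iffI allI impI)
  fix j m
  assume "\<forall>j m. lo + m \<le> j \<longrightarrow>
      (\<forall>k<Suc m. (\<forall>i<k. d (j - i) = wmax a b i) \<longrightarrow> d (j - k) \<le> wmax a b k)"
    "lo + m \<le> j" "\<forall>i<m. d (j - i) = wmax a b i"
  then show "d (j - m) \<le> wmax a b m" by blast
next
  fix j m k
  assume "\<forall>j m. lo + m \<le> j \<longrightarrow> (\<forall>i<m. d (j - i) = wmax a b i) \<longrightarrow> d (j - m) \<le> wmax a b m"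
    "lo + m \<le> j" "k < Suc m" "\<forall>i<k. d (j - i) = wmax a b i"
  moreover from this have "lo + k \<le> j" by linarith
  ultimately show "d (j - k) \<le> wmax a b k" by blast
qed

lemma blocks_okD:
  "blocks_ok a b lo d \<Longrightarrow> lo + m \<le> j \<Longrightarrow> (\<And>i. i < m \<Longrightarrow> d (j - i) = wmax a b i)
     \<Longrightarrow> d (j - m) \<le> wmax a b m"
  unfolding blocks_ok_iff by blast

text \<open>A block that agrees with \<open>wmax\<close> in its first digit starts with a - 1, and a
  + b - 1 is the smallest entry of \<open>wmax\<close>. All explicit digit sequences below are
  checked through this crude criterion.\<close>

lemma blocks_okI:
  assumes "\<And>j. lo \<le> j \<Longrightarrow> d j \<le> a - 1"
    and "\<And>i j. lo \<le> i \<Longrightarrow> i < j \<Longrightarrow> d j = a - 1 \<Longrightarrow> d i \<le> a + b - 1"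
  shows "blocks_ok a b lo d"
  unfolding blocks_ok_iff
proof (intro allI impI)
  fix j m
  assume jm: "lo + m \<le> j" and eq: "\<forall>i<m. d (j - i) = wmax a b i"
  show "d (j - m) \<le> wmax a b m"
  proof (cases "m = 0")
    case True
    then show ?thesis using assms(1)[of j] jm by (simp add: wmax_def)
  next
    case False
    then have "d j = a - 1" using eq by (auto simp: wmax_def)
    then have "d (j - m) \<le> a + b - 1" using assms(2)[of "j - m" j] jm False by simp
    then show ?thesis using False by (auto simp: wmax_def)
  qed
qed

lemma blocks_ok_cong:
  assumes "\<And>i. lo \<le> i \<Longrightarrow> d i = e i" and "blocks_ok a b lo d"
  shows "blocks_ok a b lo e"
  unfolding blocks_ok_iff
proof (intro allI impI)
  fix j m
  assume jm: "lo + m \<le> j" and eq: "\<forall>i<m. e (j - i) = wmax a b i"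
  have "d (j - i) = e (j - i)" if "i \<le> m" for i
    using that jm by (intro assms(1)) simp
  then show "e (j - m) \<le> wmax a b m"
    using blocks_okD[OF assms(2) jm] eq by simp
qed

lemma blocks_ok_shift: "blocks_ok a b lo d \<Longrightarrow> blocks_ok a b lo (\<lambda>i. d (Suc i))"
  unfolding blocks_ok_iff
proof (intro allI impI)
  fix j m
  assume ok: "\<forall>j m. lo + m \<le> j \<longrightarrow> (\<forall>i<m. d (j - i) = wmax a b i) \<longrightarrow> d (j - m) \<le> wmax a b m"
    and jm: "lo + m \<le> j" and eq: "\<forall>i<m. d (Suc (j - i)) = wmax a b i"
  have "Suc j - i = Suc (j - i)" if "i \<le> m" for i using that jm by simp
  then show "d (Suc (j - m)) \<le> wmax a b m"
    using ok[rule_format, of m "Suc j"] jm eq by simp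
qed

lemma sum_split_top:
  fixes f :: "nat \<Rightarrow> 'a::comm_monoid_add"
  assumes "m \<le> n"
  shows "(\<Sum>j<n. f j) = (\<Sum>i<m. f (n - 1 - i)) + (\<Sum>j<n - m. f j)"
  using assms
proof (induction m)
  case (Suc m)
  then obtain k where k: "n - m = Suc k" by (metis Suc_diff_Suc Suc_le_lessD)
  then have "n - 1 - m = k" "n - Suc m = k" by auto
  then show ?case using Suc k by (simp add: ac_simps)
qed auto

section \<open>Existence and uniqueness of \<open>T\<close>-representations\<close>

locale rauzy_params =
  fixes a b :: int
  assumes hb1: "- a + 1 \<le> b" and hb2: "b \<le> -2"
begin

lemma wmax_nonneg: "0 \<le> wmax a b i"
  using hb1 hb2 by (auto simp: wmax_def)

definition max_word_value :: "nat \<Rightarrow> int" where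
  "max_word_value n = (\<Sum>i<n. wmax a b i * T a b (n - 1 - i))"

lemma max_word_value_Suc_Suc_Suc:
  "max_word_value (Suc (Suc (Suc n))) = (a - 1) * T a b (Suc (Suc n)) + (a + b - 1) * T a b (Suc n)
     + (a + b) * (\<Sum>i\<le>n. T a b (n - i))"
proof -
  have "(\<Sum>i<Suc n. wmax a b (Suc (Suc i)) * T a b (n - i)) = (a + b) * (\<Sum>i\<le>n. T a b (n - i))"
    by (simp add: wmax_def sum_distrib_left lessThan_Suc_atMost del: T.simps sum.lessThan_Suc)
  then show ?thesis
    unfolding max_word_value_def sum.lessThan_Suc_shift[of _ "Suc (Suc n)"] sum.lessThan_Suc_shift[of _ "Suc n"]
    by (simp add: wmax_def del: T.simps sum.lessThan_Suc)
qed

text \<open>The analogue of 99...9 = 10^n - 1: the lexicographically largest word of length n has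
  value T_n - 1. Lengthening the word from n + 3 to n + 4 adds (a - 1) T_(n+3) + b T_(n+2) +
  T_(n+1), which by the recurrence is T_(n+4) - T_(n+3). Lengths up to 3 are computed
  directly.\<close>

lemma T_eq_max_word_value: "T a b n = max_word_value n + 1"
proof -
  have key: "T a b (Suc (Suc (Suc n))) = max_word_value (Suc (Suc (Suc n))) + 1" for n
  proof (induction n)
    case 0
    show ?case unfolding max_word_value_Suc_Suc_Suc by (simp add: algebra_simps power2_eq_square)
  next
    case (Suc n)
    have "(\<Sum>i\<le>Suc n. T a b (Suc n - i)) = T a b (Suc n) + (\<Sum>i\<le>n. T a b (n - i))"
      by (simp add: sum.atMost_Suc_shift del: T.simps sum.atMost_Suc)
    then show ?case using Suc unfolding max_word_value_Suc_Suc_Suc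
      by (simp add: algebra_simps)
  qed
  consider "n = 0" | "n = Suc 0" | "n = Suc (Suc 0)" | k where "n = Suc (Suc (Suc k))"
    by (metis not0_implies_Suc)
  then show ?thesis
    using key by cases (auto simp: max_word_value_def wmax_def algebra_simps power2_eq_square simp del: T.simps(4))
qed

text \<open>Since b is negative, the recurrence itself does not show positivity; the expansion of
  T_n - 1 with the nonnegative digits \<open>wmax\<close> does.\<close>

lemma T_pos: "0 < T a b n"
proof (induction n rule: less_induct)
  case (less n)
  have "0 \<le> max_word_value n" unfolding max_word_value_def
    by (rule sum_nonneg, rule mult_nonneg_nonneg[OF wmax_nonneg less_imp_le], rule less) auto
  then show ?case using T_eq_max_word_value[of n] by simp
qed

lemma T_Suc_gt: "T a b n < T a b (Suc n)"
proof -
  have "T a b (Suc n) = 1 + ((a - 1) * T a b n + (\<Sum>i<n. wmax a b (Suc i) * T a b (n - 1 - i)))"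
    unfolding T_eq_max_word_value[of "Suc n"] max_word_value_def by (simp add: sum.lessThan_Suc_shift wmax_def del: sum.lessThan_Suc)
  moreover have "0 \<le> (\<Sum>i<n. wmax a b (Suc i) * T a b (n - 1 - i))"
    by (intro sum_nonneg mult_nonneg_nonneg wmax_nonneg less_imp_le[OF T_pos])
  moreover have "1 * T a b n \<le> (a - 1) * T a b n"
    using T_pos[of n] hb1 hb2 by (intro mult_right_mono) auto
  ultimately show ?thesis by simp
qed

lemma T_gt: "int n < T a b n"
proof (induction n)
  case (Suc n)
  then show ?case using T_Suc_gt[of n] by simp
qed auto

text \<open>The top n digits are compared with the largest word. At the first disagreement the digit
  is smaller by at least one, which loses T_(n-1-m); by induction the digits below it cannot make up
  for that loss. Without a disagreement the sum is exactly T_n - 1.\<close>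

lemma admissible_sum_less:
  assumes "\<And>j. 0 \<le> d j" and "blocks_ok a b 0 d"
  shows "(\<Sum>j<n. d j * T a b j) < T a b n"
proof (induction n rule: less_induct)
  case (less n)
  show ?case
  proof (cases "\<forall>i<n. d (n - 1 - i) = wmax a b i")
    case True
    have "(\<Sum>j<n. d j * T a b j) = (\<Sum>i<n. d (n - 1 - i) * T a b (n - 1 - i))"
      using sum_split_top[of n n "\<lambda>j. d j * T a b j"] by simp
    also have "\<dots> = max_word_value n" unfolding max_word_value_def using True by simp
    finally show ?thesis using T_eq_max_word_value[of n] by simp
  next
    case False
    then obtain m where "m < n" "d (n - 1 - m) \<noteq> wmax a b m"
      "\<forall>k<m. \<not> (k < n \<and> d (n - 1 - k) \<noteq> wmax a b k)"
      using exists_least_iff[of "\<lambda>i. i < n \<and> d (n - 1 - i) \<noteq> wmax a b i"] by blast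
    then have m: "m < n" "d (n - 1 - m) \<noteq> wmax a b m" "\<And>k. k < m \<Longrightarrow> d (n - 1 - k) = wmax a b k"
      by auto
    then have "d (n - 1 - m) \<le> wmax a b m"
      by (intro blocks_okD[OF assms(2)]) auto
    then have le: "d (n - 1 - m) \<le> wmax a b m - 1" using m(2) by simp
    have eqn: "n - Suc m = n - 1 - m" by simp
    have "(\<Sum>j<n. d j * T a b j) = (\<Sum>i<m. d (n - 1 - i) * T a b (n - 1 - i))
        + d (n - 1 - m) * T a b (n - 1 - m) + (\<Sum>j<n - 1 - m. d j * T a b j)"
      using sum_split_top[of "Suc m" n "\<lambda>j. d j * T a b j"] m(1) unfolding eqn by simp
    also have "\<dots> < (\<Sum>i<m. wmax a b i * T a b (n - 1 - i))
        + (wmax a b m - 1) * T a b (n - 1 - m) + T a b (n - 1 - m)"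
    proof (rule add_le_less_mono)
      show "(\<Sum>j<n - 1 - m. d j * T a b j) < T a b (n - 1 - m)"
        using m(1) by (intro less) auto
      show "(\<Sum>i<m. d (n - 1 - i) * T a b (n - 1 - i)) + d (n - 1 - m) * T a b (n - 1 - m)
         \<le> (\<Sum>i<m. wmax a b i * T a b (n - 1 - i)) + (wmax a b m - 1) * T a b (n - 1 - m)"
        using m(3) le T_pos[of "n - 1 - m"] by (intro add_mono mult_right_mono) auto
    qed
    also have "\<dots> = (\<Sum>i<Suc m. wmax a b i * T a b (n - 1 - i))"
      by (simp add: algebra_simps)
    also have "\<dots> \<le> max_word_value n" unfolding max_word_value_def
      using m(1) by (intro sum_mono2) (auto intro!: mult_nonneg_nonneg wmax_nonneg less_imp_le[OF T_pos])
    finally show ?thesis using T_eq_max_word_value[of n] by simp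
  qed
qed

text \<open>The highest differing digit decides, because the digits of \<open>d\<close> below
  position n are worth less than a single T_n.\<close>

lemma admissible_sum_less_if_differ:
  assumes d: "\<And>j. 0 \<le> d j" "blocks_ok a b 0 d" and e: "\<And>j. 0 \<le> e j"
    and n: "d n < e n" "\<And>j. j > n \<Longrightarrow> d j = e j" and "n < N"
  shows "(\<Sum>j<N. d j * T a b j) < (\<Sum>j<N. e j * T a b j)"
proof -
  have split: "(\<Sum>j<N. f j) = (\<Sum>j<n. f j) + f n + (\<Sum>j\<in>{n<..<N}. f j)" for f :: "nat \<Rightarrow> int"
  proof -
    have "{..<N} = {..<n} \<union> {n} \<union> {n<..<N}" using \<open>n < N\<close> by auto
    moreover have "{..<n} \<inter> {n<..<N} = {}" by auto
    ultimately show ?thesis by (simp add: sum.union_disjoint)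
  qed
  have "(\<Sum>j<n. d j * T a b j) + d n * T a b n < T a b n + d n * T a b n"
    using admissible_sum_less[OF d] by simp
  also have "\<dots> = (d n + 1) * T a b n" by (simp add: algebra_simps)
  also have "\<dots> \<le> e n * T a b n" using n T_pos[of n] by (intro mult_right_mono) auto
  also have "\<dots> \<le> (\<Sum>j<n. e j * T a b j) + e n * T a b n"
    using e by (simp add: sum_nonneg less_imp_le[OF T_pos])
  finally show ?thesis
    unfolding split[of "\<lambda>j. d j * T a b j"] split[of "\<lambda>j. e j * T a b j"] using n by simp
qed

lemma is_Trep_sum:
  assumes "is_Trep a b q d"
  obtains k where "\<And>N. k < N \<Longrightarrow> q = (\<Sum>j<N. d j * T a b j)" "\<And>j. j > k \<Longrightarrow> d j = 0"
proof -
  obtain k where k: "\<forall>j>k. d j = 0" "q = (\<Sum>j\<le>k. d j * T a b j)"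
    using assms unfolding is_Trep_def by blast
  have "q = (\<Sum>j<N. d j * T a b j)" if "k < N" for N
    unfolding k(2) using that k(1) by (intro sum.mono_neutral_left) auto
  then show thesis using that k(1) by blast
qed

lemma is_Trep_unique:
  assumes "is_Trep a b q d" "is_Trep a b q e"
  shows "d = e"
proof (rule ccontr)
  assume "d \<noteq> e"
  then obtain i where i: "d i \<noteq> e i" by blast
  obtain k where k: "\<And>N. k < N \<Longrightarrow> q = (\<Sum>j<N. d j * T a b j)" "\<And>j. j > k \<Longrightarrow> d j = 0"
    using is_Trep_sum[OF assms(1)] by blast
  obtain l where l: "\<And>N. l < N \<Longrightarrow> q = (\<Sum>j<N. e j * T a b j)" "\<And>j. j > l \<Longrightarrow> e j = 0"
    using is_Trep_sum[OF assms(2)] by blast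
  define n where "n = Max {j. d j \<noteq> e j}"
  have "{j. d j \<noteq> e j} \<subseteq> {..max k l}"
    using k(2) l(2) by (auto simp: not_le[symmetric]) (metis max.coboundedI1 max.coboundedI2 not_le)
  then have fin: "finite {j. d j \<noteq> e j}" by (rule finite_subset) simp
  have "n \<in> {j. d j \<noteq> e j}" unfolding n_def using i by (intro Max_in[OF fin]) auto
  then have n: "d n \<noteq> e n" "\<And>j. j > n \<Longrightarrow> d j = e j"
    using Max_ge[OF fin] unfolding n_def by (auto simp: not_le[symmetric])
  define N where "N = Suc (max n (max k l))"
  have N: "n < N" "k < N" "l < N" by (auto simp: N_def)
  have "d n < e n \<or> e n < d n" using n(1) by auto
  then show False
    using admissible_sum_less_if_differ[of d e n N] admissible_sum_less_if_differ[of e d n N]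
      n(2) N k(1)[OF N(2)] l(1)[OF N(3)] assms
    unfolding is_Trep_def by auto
qed

text \<open>Greedy algorithm: the top digit is the quotient of q by T_n, and the remainder is
  expanded by induction. Only blocks that start at the new top digit need a new argument.\<close>

lemma greedy_exists:
  assumes "0 \<le> q" "q < T a b n"
  shows "\<exists>d. (\<forall>j. 0 \<le> d j \<and> d j \<le> a - 1) \<and> (\<forall>j\<ge>n. d j = 0) \<and>
     q = (\<Sum>j<n. d j * T a b j) \<and> blocks_ok a b 0 d"
  using assms
proof (induction n arbitrary: q)
  case 0
  then show ?case using hb1 hb2 by (intro exI[of _ "\<lambda>_. 0"]) (auto intro!: blocks_okI)
next
  case (Suc n)
  define t where "t = q div T a b n"
  have "0 \<le> q mod T a b n" "q mod T a b n < T a b n" using T_pos[of n] by auto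
  from Suc.IH[OF this] obtain d where d: "\<And>j. 0 \<le> d j" "\<And>j. d j \<le> a - 1" "\<And>j. n \<le> j \<Longrightarrow> d j = 0"
    "q mod T a b n = (\<Sum>j<n. d j * T a b j)" "blocks_ok a b 0 d"
    by blast
  define e where "e = d(n := t)"
  have q: "q = (\<Sum>j<Suc n. e j * T a b j)"
    using d(4) div_mult_mod_eq[of q "T a b n"] by (simp add: e_def t_def)
  have e0: "0 \<le> e j" for j
    using d(1) Suc.prems T_pos[of n] by (auto simp: e_def t_def pos_imp_zdiv_nonneg_iff)
  \<comment> \<open>Exceeding the largest word at offset m would push q above
    \<open>max_word_value (Suc n)\<close>, hence to at least T_(n+1).\<close>
  have top: "e (n - m) \<le> wmax a b m" if m: "m \<le> n" "\<forall>i<m. e (n - i) = wmax a b i" for m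
  proof (rule ccontr)
    assume "\<not> e (n - m) \<le> wmax a b m"
    then have gt: "wmax a b m + 1 \<le> e (n - m)" by simp
    \<comment> \<open>The digits of the largest word that remain after offset m. They are all below
      a - 1, so no block can start to agree with \<open>wmax\<close>; thus \<open>f\<close> is
      admissible and its value stays below T_(n-m).\<close>
    define f where "f j = (if j < n - m then wmax a b (n - j) else 0)" for j
    have f: "0 \<le> f j" "f j < a - 1" for j
      using wmax_nonneg hb1 hb2 by (auto simp: f_def wmax_def)
    have "blocks_ok a b 0 f"
      using f by (intro blocks_okI) (auto intro: less_imp_le simp: less_le)
    then have tail: "(\<Sum>j<n - m. wmax a b (n - j) * T a b j) < T a b (n - m)"
      using admissible_sum_less[of f "n - m"] f by (simp add: f_def)
    have "max_word_value (Suc n) = (\<Sum>j<Suc n. wmax a b (n - j) * T a b j)"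
      using sum_split_top[of "Suc n" "Suc n" "\<lambda>j. wmax a b (n - j) * T a b j"]
      by (simp add: max_word_value_def del: sum.lessThan_Suc)
    also have "\<dots> = (\<Sum>i<m. wmax a b i * T a b (n - i)) + wmax a b m * T a b (n - m)
        + (\<Sum>j<n - m. wmax a b (n - j) * T a b j)"
      using sum_split_top[of "Suc m" "Suc n" "\<lambda>j. wmax a b (n - j) * T a b j"] m(1) by simp
    also have "\<dots> < (\<Sum>i<m. wmax a b i * T a b (n - i)) + (wmax a b m + 1) * T a b (n - m)"
      using tail by (simp add: algebra_simps)
    also have "\<dots> \<le> (\<Sum>i<m. e (n - i) * T a b (n - i)) + e (n - m) * T a b (n - m)"
      using gt m(2) T_pos[of "n - m"] by (intro add_mono mult_right_mono) auto
    also have "\<dots> \<le> (\<Sum>i<m. e (n - i) * T a b (n - i)) + e (n - m) * T a b (n - m)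
        + (\<Sum>j<n - m. e j * T a b j)"
      using e0 by (simp add: sum_nonneg less_imp_le[OF T_pos])
    also have "\<dots> = q" unfolding q
      using sum_split_top[of "Suc m" "Suc n" "\<lambda>j. e j * T a b j"] m(1) by simp
    finally show False using Suc.prems T_eq_max_word_value[of "Suc n"] by simp
  qed
  have e1: "e j \<le> a - 1" for j
    using d(2)[of j] top[of 0] by (auto simp: e_def wmax_def)
  have "blocks_ok a b 0 e"
    unfolding blocks_ok_iff
  proof (intro allI impI)
    fix j m
    assume jm: "0 + m \<le> j" and eq: "\<forall>i<m. e (j - i) = wmax a b i"
    consider "j < n" | "j = n" | "j > n" by linarith
    then show "e (j - m) \<le> wmax a b m"
    proof cases
      case 1
      then have "e (j - i) = d (j - i)" for i by (auto simp: e_def)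
      then show ?thesis using blocks_okD[OF d(5), of m j] jm eq by simp
    next
      case 2
      then show ?thesis using top jm eq by simp
    next
      case 3
      then have "e j = 0" using d(3) by (simp add: e_def)
      then have "m = 0" using eq hb1 hb2 by (auto simp: wmax_def intro: ccontr)
      then show ?thesis using e1 by (simp add: wmax_def)
    qed
  qed
  moreover have "\<forall>j\<ge>Suc n. e j = 0" using d(3) by (simp add: e_def)
  ultimately show ?case using q e0 e1 by blast
qed

text \<open>Justifies the definite description in \<open>Trep\<close>. The bound n < T_n supplies a
  length for the greedy expansion.\<close>

lemma Trep_is_Trep:
  assumes "0 < q"
  shows "is_Trep a b q (Trep a b q)"
proof -
  have "q < T a b (nat q)" using T_gt[of "nat q"] assms by simp
  then obtain d where d: "\<forall>j. 0 \<le> d j \<and> d j \<le> a - 1" "\<forall>j\<ge>nat q. d j = 0"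
      "q = (\<Sum>j<nat q. d j * T a b j)" "blocks_ok a b 0 d"
    using greedy_exists[of q "nat q"] assms by auto
  have "q = (\<Sum>j\<le>nat q. d j * T a b j)"
    using d(2,3) by (simp add: lessThan_Suc_atMost[symmetric])
  then have rep: "is_Trep a b q d"
    unfolding is_Trep_def using d by (intro conjI exI[of _ "nat q"]) auto
  show ?thesis
    unfolding Trep_def by (rule theI[where P = "is_Trep a b q", OF rep is_Trep_unique[OF _ rep]])
qed

end

section \<open>Discreteness of the lattice\<close>

lemma int_combination_eq_iff:
  fixes \<alpha> :: complex
  assumes "Im \<alpha> \<noteq> 0"
  shows "of_int m + of_int n * \<alpha> = of_int m' + of_int n' * \<alpha> \<longleftrightarrow> m = m' \<and> n = n'"
  using assms by (auto simp: complex_eq_iff)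

text \<open>Distinct lattice points are at least min(1, |Im \<alpha>|) apart: either their imaginary
  parts differ by a nonzero multiple of Im \<alpha>, or they differ by a nonzero integer.\<close>

lemma closed_lattice_subset:
  assumes "Im \<alpha> \<noteq> 0" and "S \<subseteq> tiling_lattice \<alpha>"
  shows "closed S"
proof (rule discrete_imp_closed[of "min 1 \<bar>Im \<alpha>\<bar>"])
  show "0 < min 1 \<bar>Im \<alpha>\<bar>" using assms(1) by simp
  show "\<forall>x\<in>S. \<forall>y\<in>S. dist y x < min 1 \<bar>Im \<alpha>\<bar> \<longrightarrow> y = x"
  proof (intro ballI impI)
    fix x y
    assume xy: "x \<in> S" "y \<in> S" "dist y x < min 1 \<bar>Im \<alpha>\<bar>"
    obtain m n where x: "x = of_int m + of_int n * \<alpha>"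
      using xy(1) assms(2) unfolding tiling_lattice_def by blast
    obtain m' n' where y: "y = of_int m' + of_int n' * \<alpha>"
      using xy(2) assms(2) unfolding tiling_lattice_def by blast
    have diff: "y - x = of_int (m' - m) + of_int (n' - n) * \<alpha>"
      by (simp add: x y algebra_simps)
    have "\<bar>Im (y - x)\<bar> < \<bar>Im \<alpha>\<bar>"
      using abs_Im_le_cmod[of "y - x"] xy(3) by (simp add: dist_norm)
    then have "\<bar>real_of_int (n' - n)\<bar> * \<bar>Im \<alpha>\<bar> < 1 * \<bar>Im \<alpha>\<bar>"
      unfolding diff by (simp add: abs_mult)
    then have "\<bar>real_of_int (n' - n)\<bar> < 1" using assms(1) by (simp add: mult_less_cancel_right del: of_int_diff)
    then have n: "n' - n = 0" by linarith
    then have "cmod (of_int (m' - m)) < 1" using xy(3) diff by (simp add: dist_norm)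
    then have "\<bar>real_of_int (m' - m)\<bar> < 1" unfolding norm_of_int by simp
    then have "m' - m = 0" by linarith
    with n show "y = x" by (simp add: x y)
  qed
qed

section \<open>Roots of the cubic and the Rauzy norm\<close>

locale rauzy = rauzy_params +
  fixes \<beta> :: real and \<alpha> :: complex
  assumes hbeta: "\<beta> ^ 3 - of_int a * \<beta> ^ 2 - of_int b * \<beta> - 1 = 0"
    and halpha: "\<alpha> ^ 3 - of_int a * \<alpha> ^ 2 - of_int b * \<alpha> - 1 = 0"
    and hnonreal: "Im \<alpha> \<noteq> 0"
    and hless: "cmod \<alpha> < \<beta>"
begin

lemma alpha_cube: "\<alpha> ^ 3 = of_int a * \<alpha> ^ 2 + of_int b * \<alpha> + 1"
  using halpha by (simp add: algebra_simps)

lemma alpha_nonzero: "\<alpha> \<noteq> 0"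
  using hnonreal by auto

lemma alpha_neq_1: "\<alpha> \<noteq> 1"
  using hnonreal by auto

lemma beta_pos: "0 < \<beta>"
  using hless norm_ge_zero[of \<alpha>] by linarith

text \<open>Both \<alpha> and its conjugate are roots of the quotient of the cubic by z - \<beta>.
  Subtracting the two quadratic equations and cancelling their nonzero difference leaves the sum of
  the roots.\<close>

lemma vieta_sum: "cnj \<alpha> = of_int a - of_real \<beta> - \<alpha>"
proof -
  define B where "B = complex_of_real \<beta>"
  have B: "B ^ 3 - of_int a * B ^ 2 - of_int b * B - 1 = 0"
    using arg_cong[OF hbeta, of complex_of_real] by (simp add: B_def)
  have quad: "z ^ 2 + z * B + B ^ 2 - of_int a * (z + B) - of_int b = 0"
    if z: "z ^ 3 - of_int a * z ^ 2 - of_int b * z - 1 = 0" "Im z \<noteq> 0" for z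
  proof -
    have "(z - B) * (z ^ 2 + z * B + B ^ 2 - of_int a * (z + B) - of_int b) = 0"
      using B z(1) by algebra
    moreover have "z - B \<noteq> 0" using z(2) by (auto simp: B_def)
    ultimately show ?thesis by simp
  qed
  have "cnj \<alpha> ^ 3 - of_int a * cnj \<alpha> ^ 2 - of_int b * cnj \<alpha> - 1 = 0"
    using arg_cong[OF halpha, of cnj] by simp
  from quad[OF this] quad[OF halpha hnonreal] hnonreal
  have "cnj \<alpha> ^ 2 + cnj \<alpha> * B + B ^ 2 - of_int a * (cnj \<alpha> + B) - of_int b = 0"
    "\<alpha> ^ 2 + \<alpha> * B + B ^ 2 - of_int a * (\<alpha> + B) - of_int b = 0"
    by simp_all
  then have "(\<alpha> - cnj \<alpha>) * (\<alpha> + cnj \<alpha> + B - of_int a) = 0"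
    by algebra
  moreover have "\<alpha> - cnj \<alpha> \<noteq> 0" using hnonreal by (auto simp: complex_eq_iff)
  ultimately have "\<alpha> + cnj \<alpha> + B - of_int a = 0" by simp
  then show ?thesis unfolding B_def by algebra
qed

lemma vieta_prod: "\<alpha> * cnj \<alpha> * of_real \<beta> = 1"
proof -
  define B where "B = complex_of_real \<beta>"
  have B: "B ^ 3 - of_int a * B ^ 2 - of_int b * B - 1 = 0"
    using arg_cong[OF hbeta, of complex_of_real] by (simp add: B_def)
  have nz: "\<alpha> - B \<noteq> 0" using hnonreal by (auto simp: B_def)
  have "(\<alpha> - B) * (\<alpha> * (of_int a - B - \<alpha>) * B - 1) = 0"
    using B halpha by algebra
  then show ?thesis using nz unfolding vieta_sum B_def by simp
qed

lemma norm_alpha_less_1: "cmod \<alpha> < 1"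
proof (rule ccontr)
  assume "\<not> cmod \<alpha> < 1"
  then have 1: "1 \<le> cmod \<alpha>" by simp
  have "cmod \<alpha> * cmod \<alpha> * \<beta> = 1"
    using arg_cong[OF vieta_prod, of cmod] beta_pos by (simp add: norm_mult)
  moreover have "1 * 1 * 1 < cmod \<alpha> * cmod \<alpha> * \<beta>"
    using 1 hless by (intro mult_le_less_imp_less mult_mono) auto
  ultimately show False by simp
qed

text \<open>Links the norm to the complex plane: multiplying by -\<beta> \<open>cnj \<alpha>\<close>
  turns the expression inside the norm into the conjugate of the element of Z[\<alpha>] on the
  right.\<close>

lemma rauzy_norm_eq:
  "\<beta> * cmod \<alpha> * rauzy_norm b \<beta> \<alpha> (real_of_int q / \<beta> - real_of_int g1, real_of_int q / \<beta> ^ 2 - real_of_int g2)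
    = cmod (of_int q * \<alpha> ^ 2 + of_int g1 * (1 + of_int b * \<alpha>) + of_int g2 * \<alpha>)"
proof -
  define B where "B = complex_of_real \<beta>"
  have B: "B ^ 3 - of_int a * B ^ 2 - of_int b * B - 1 = 0"
    using arg_cong[OF hbeta, of complex_of_real] by (simp add: B_def)
  have B0: "B \<noteq> 0" using beta_pos by (simp add: B_def)
  define I where "I = inverse B"
  have I: "B * I = 1" using B0 by (simp add: I_def)
  define X where "X = (\<alpha> + of_int b * I) * (of_int q * I - of_int g1) + (of_int q * I ^ 2 - of_int g2) * I"
  have N: "rauzy_norm b \<beta> \<alpha> (real_of_int q / \<beta> - real_of_int g1, real_of_int q / \<beta> ^ 2 - real_of_int g2)
      = cmod X"
    unfolding rauzy_norm_def X_def I_def B_def by (simp add: divide_inverse power_inverse)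
  define c where "c = cnj \<alpha>"
  have c: "c = of_int a - B - \<alpha>" "\<alpha> * c * B = 1"
    using vieta_sum vieta_prod by (auto simp: B_def c_def)
  \<comment> \<open>The cubic for \<beta> divided by \<beta>^2. With the sum of the roots it gives
    \<alpha> + b/\<beta> + 1/\<beta>^2 = -c, which makes the coefficient of q equal to c^2.\<close>
  have "of_int b * I + I ^ 2 = B - of_int a"
    using B I by algebra
  then have "- c * (\<alpha> + of_int b * I + I ^ 2) = c ^ 2"
    using c(1) by algebra
  moreover have "- B * c * X = of_int q * (- c * (\<alpha> + of_int b * I + I ^ 2))
      + of_int g1 * (\<alpha> * c * B + of_int b * c) + of_int g2 * c"
    using I unfolding X_def by algebra
  ultimately have "- B * c * X = of_int q * c ^ 2 + of_int g1 * (1 + of_int b * c) + of_int g2 * c"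
    using c(2) by simp
  also have "\<dots> = cnj (of_int q * \<alpha> ^ 2 + of_int g1 * (1 + of_int b * \<alpha>) + of_int g2 * \<alpha>)"
    by (simp add: c_def)
  finally have "cmod (- B * c * X) = cmod (of_int q * \<alpha> ^ 2 + of_int g1 * (1 + of_int b * \<alpha>) + of_int g2 * \<alpha>)"
    by (metis complex_mod_cnj)
  then show ?thesis unfolding N using beta_pos by (simp add: norm_mult B_def c_def)
qed

section \<open>The Rauzy fractal: self-similarity and compactness\<close>

definition expansion :: "(nat \<Rightarrow> int) \<Rightarrow> complex" where
  "expansion d = (\<Sum>i. of_int (d (i + 2)) * \<alpha> ^ (i + 2))"

lemma rauzy_fractal_eq: "rauzy_fractal a b \<alpha> = expansion ` Collect (admissible_inf a b)"
  unfolding rauzy_fractal_def expansion_def by auto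

lemma norm_term_le:
  assumes "0 \<le> d" "d \<le> a - 1"
  shows "norm (of_int d * \<alpha> ^ n) \<le> of_int (a - 1) * cmod \<alpha> ^ n"
  using assms by (simp add: norm_mult norm_power mult_right_mono)

lemma summable_bound: "summable (\<lambda>i. of_int (a - 1) * cmod \<alpha> ^ (i + 2))"
  by (rule summable_mult[OF summable_ignore_initial_segment[OF summable_geometric]])
    (simp add: norm_alpha_less_1)

lemma summable_expansion:
  assumes "admissible_inf a b d"
  shows "summable (\<lambda>i. of_int (d (i + 2)) * \<alpha> ^ (i + 2))"
  using assms by (intro summable_comparison_test'[OF summable_bound, of 0] norm_term_le)
    (auto simp: admissible_inf_def)

lemma expansion_in_rauzy_fractal: "admissible_inf a b d \<Longrightarrow> expansion d \<in> rauzy_fractal a b \<alpha>"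
  unfolding rauzy_fractal_eq by simp

lemma expansion_const_tail:
  assumes "admissible_inf a b d" and "\<And>i. N + 2 \<le> i \<Longrightarrow> d i = c"
  shows "expansion d = (\<Sum>i<N. of_int (d (i + 2)) * \<alpha> ^ (i + 2)) + of_int c * \<alpha> ^ (N + 2) / (1 - \<alpha>)"
proof -
  have "expansion d = (\<Sum>i. of_int (d (i + N + 2)) * \<alpha> ^ (i + N + 2)) + (\<Sum>i<N. of_int (d (i + 2)) * \<alpha> ^ (i + 2))"
    unfolding expansion_def by (rule suminf_split_initial_segment[OF summable_expansion[OF assms(1)]])
  also have "(\<lambda>i. of_int (d (i + N + 2)) * \<alpha> ^ (i + N + 2)) = (\<lambda>i. (of_int c * \<alpha> ^ (N + 2)) * \<alpha> ^ i)"
    using assms(2) by (auto simp: power_add algebra_simps)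
  also have "(\<Sum>i. (of_int c * \<alpha> ^ (N + 2)) * \<alpha> ^ i) = of_int c * \<alpha> ^ (N + 2) * (1 / (1 - \<alpha>))"
    using norm_alpha_less_1 by (simp add: suminf_mult suminf_geometric summable_geometric)
  finally show ?thesis by simp
qed

text \<open>Deleting the lowest digit preserves admissibility, so what remains is \<alpha> times
  another point of the fractal. This serves to rule out lattice points later.\<close>

lemma rauzy_fractal_shift:
  assumes "x \<in> rauzy_fractal a b \<alpha>"
  obtains d y where "0 \<le> d" "d \<le> a - 1" "y \<in> rauzy_fractal a b \<alpha>" "x = of_int d * \<alpha> ^ 2 + \<alpha> * y"
proof -
  obtain d where d: "admissible_inf a b d" "x = expansion d"
    using assms unfolding rauzy_fractal_eq by auto
  have adm: "admissible_inf a b (\<lambda>i. d (Suc i))"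
    using d(1) blocks_ok_shift unfolding admissible_inf_def by auto
  have "x = (\<Sum>i. of_int (d (i + 1 + 2)) * \<alpha> ^ (i + 1 + 2)) + (\<Sum>i<1. of_int (d (i + 2)) * \<alpha> ^ (i + 2))"
    unfolding d(2) expansion_def by (rule suminf_split_initial_segment[OF summable_expansion[OF d(1)]])
  also have "(\<Sum>i. of_int (d (i + 1 + 2)) * \<alpha> ^ (i + 1 + 2)) = \<alpha> * expansion (\<lambda>i. d (Suc i))"
    unfolding expansion_def suminf_mult[OF summable_expansion[OF adm], symmetric]
    by (simp add: algebra_simps)
  finally have "x = of_int (d 2) * \<alpha> ^ 2 + \<alpha> * expansion (\<lambda>i. d (Suc i))" by (simp add: numeral_2_eq_2)
  moreover have "0 \<le> d 2" "d 2 \<le> a - 1" using d(1) by (auto simp: admissible_inf_def)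
  ultimately show thesis using that expansion_in_rauzy_fractal[OF adm] by blast
qed

definition digit_seqs :: "(nat \<Rightarrow> int) set" where
  "digit_seqs = (\<Pi>\<^sub>E i\<in>UNIV. {0..a - 1})"

lemma compact_digit_seqs: "compact digit_seqs"
  unfolding digit_seqs_def
  unfolding compactin_euclidean_iff[symmetric] euclidean_product_topology[symmetric]
  by (auto simp: compactin_PiE intro: finite_imp_compact)

lemma continuous_on_eval: "continuous_on S (\<lambda>d::nat \<Rightarrow> int. d i)"
  by (rule continuous_on_subset[OF continuous_on_product_coordinates subset_UNIV])

text \<open>Each instance of the block condition involves finitely many coordinates with values in a
  discrete space, so its premise is open and its conclusion closed in the product topology.\<close>

lemma closed_blocks_ok: "closed {d. blocks_ok a b lo d}"
  unfolding blocks_ok_iff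
proof (intro closed_Collect_all closed_Collect_imp)
  fix j m
  show "closed {d. d (j - m) \<le> wmax a b m}"
    by (intro closed_Collect_le continuous_on_eval continuous_on_const)
  have "open {d::nat \<Rightarrow> int. d k = c}" for k c
  proof -
    have "{d::nat \<Rightarrow> int. d k = c} = (\<lambda>d. d k) -` {c}" by auto
    then show ?thesis using open_vimage[OF open_discrete continuous_on_eval[of UNIV k]] by metis
  qed
  then have "open (\<Inter>i\<in>{..<m}. {d. d (j - i) = wmax a b i})" by (intro open_INT) auto
  then show "open {d. \<forall>i<m. d (j - i) = wmax a b i}" by (simp add: INTER_eq Ball_def)
qed auto

lemma continuous_on_expansion: "continuous_on digit_seqs expansion"
proof -
  have lim: "uniform_limit digit_seqs (\<lambda>n d. \<Sum>i<n. of_int (d (i + 2)) * \<alpha> ^ (i + 2)) expansion sequentially"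
    unfolding expansion_def
    by (intro Weierstrass_m_test[OF _ summable_bound] norm_term_le) (auto simp: digit_seqs_def)
  have "\<forall>\<^sub>F n in sequentially. continuous_on digit_seqs (\<lambda>d. \<Sum>i<n. of_int (d (i + 2)) * \<alpha> ^ (i + 2))"
    by (intro always_eventually allI continuous_intros continuous_on_eval)
  from uniform_limit_theorem[OF this lim sequentially_bot] show ?thesis .
qed

text \<open>The admissible digit sequences form a closed subset of a product of finite sets, compact
  by Tychonoff, and \<open>expansion\<close> is continuous there by the Weierstrass M-test.\<close>

lemma compact_rauzy_fractal: "compact (rauzy_fractal a b \<alpha>)"
proof -
  define K where "K = digit_seqs \<inter> {d. blocks_ok a b 2 d}"
  have "compact K"
    unfolding K_def by (intro compact_Int_closed compact_digit_seqs closed_blocks_ok)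
  then have "compact (expansion ` K)"
    using continuous_on_expansion by (intro compact_continuous_image) (auto simp: K_def intro: continuous_on_subset)
  moreover have "expansion ` K = rauzy_fractal a b \<alpha>"
  proof
    show "expansion ` K \<subseteq> rauzy_fractal a b \<alpha>"
      by (force simp: K_def digit_seqs_def PiE_iff intro!: expansion_in_rauzy_fractal simp: admissible_inf_def)
    show "rauzy_fractal a b \<alpha> \<subseteq> expansion ` K"
    proof
      fix x
      assume "x \<in> rauzy_fractal a b \<alpha>"
      then obtain d where d: "admissible_inf a b d" "x = expansion d" unfolding rauzy_fractal_eq by auto
      \<comment> \<open>Admissibility leaves the digits 0 and 1 unconstrained. Setting them to 0
        places the sequence in \<open>digit_seqs\<close> and does not affect its expansion.\<close>
      define e where "e i = (if i < 2 then 0 else d i)" for i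
      have "blocks_ok a b 2 e"
        using d(1) blocks_ok_cong[of 2 d e a b] by (simp add: e_def admissible_inf_def)
      then have "e \<in> K" using d(1) hb1 hb2
        by (auto simp: K_def digit_seqs_def e_def admissible_inf_def)
      moreover have "expansion e = x" by (simp add: d(2) e_def expansion_def)
      ultimately show "x \<in> expansion ` K" by blast
    qed
  qed
  ultimately show ?thesis by simp
qed

text \<open>The constant tail a + b is a polynomial in \<alpha>, so the values of the explicit
  expansions reduce to polynomial identities modulo the cubic.\<close>

lemma geometric_tail_eq: "of_int (a + b) * \<alpha> / (1 - \<alpha>) = of_int a * \<alpha> - 1 - \<alpha> - \<alpha> ^ 2"
proof -
  have "of_int (a + b) * \<alpha> = (of_int a * \<alpha> - 1 - \<alpha> - \<alpha> ^ 2) * (1 - \<alpha>)"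
    using alpha_cube unfolding of_int_add by algebra
  then show ?thesis using alpha_neq_1 by (simp add: divide_eq_eq)
qed

section \<open>Lattice points and explicit neighbours\<close>

definition lat :: "int \<Rightarrow> int \<Rightarrow> complex" where
  "lat m n = of_int m + of_int n * \<alpha>"

lemma lat_eq_iff: "lat m n = lat m' n' \<longleftrightarrow> m = m' \<and> n = n'"
  unfolding lat_def by (rule int_combination_eq_iff[OF hnonreal])

lemma lat_in_lattice: "lat m n \<in> tiling_lattice \<alpha>"
  unfolding lat_def tiling_lattice_def by blast

lemma lat_diff: "lat m n - lat m' n' = lat (m - m') (n - n')"
  unfolding lat_def by (simp add: algebra_simps)

lemma lat_minus: "- lat m n = lat (- m) (- n)"
  unfolding lat_def by simp

lemma zero_in_rauzy_fractal: "lat 0 0 \<in> rauzy_fractal a b \<alpha>"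
proof -
  have "admissible_inf a b (\<lambda>_. 0)"
    using hb1 hb2 by (auto simp: admissible_inf_def intro!: blocks_okI)
  from expansion_in_rauzy_fractal[OF this] show ?thesis by (simp add: expansion_def lat_def)
qed

lemma lattice_point_in_rauzy_fractal: "lat (-1) (-1 - b) \<in> rauzy_fractal a b \<alpha>"
proof -
  define d where "d i = (if i = (2::nat) then a + b + 1 else a + b)" for i
  have adm: "admissible_inf a b d"
    using hb1 hb2 by (auto simp: admissible_inf_def d_def intro!: blocks_okI)
  have "expansion d = of_int (a + b + 1) * \<alpha> ^ 2 + \<alpha> ^ 2 * (of_int (a + b) * \<alpha> / (1 - \<alpha>))"
    using expansion_const_tail[OF adm, of 1 "a + b"] by (simp add: d_def eval_nat_numeral algebra_simps)
  also have "\<dots> = lat (-1) (-1 - b)"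
    unfolding geometric_tail_eq
    unfolding lat_def of_int_add of_int_diff of_int_minus of_int_1
    using alpha_cube by algebra
  finally show ?thesis using expansion_in_rauzy_fractal[OF adm] by simp
qed

lemma neighbourI:
  assumes "x \<in> rauzy_fractal a b \<alpha>" "y \<in> rauzy_fractal a b \<alpha>" "x - y = lat m n" "(m, n) \<noteq> (0, 0)"
  shows "lat m n \<in> neighbours a b \<alpha>"
proof -
  have "lat m n \<noteq> 0" using assms(4) lat_eq_iff[of m n 0 0] by (auto simp: lat_def)
  moreover have "x = y + lat m n" using assms(3) by (simp add: algebra_simps)
  ultimately show ?thesis unfolding neighbours_def using assms(1,2) lat_in_lattice by blast
qed

lemma neighbours_minus:
  assumes "lat m n \<in> neighbours a b \<alpha>"
  shows "lat (- m) (- n) \<in> neighbours a b \<alpha>"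
proof -
  obtain x y where xy: "x \<in> rauzy_fractal a b \<alpha>" "y \<in> rauzy_fractal a b \<alpha>" "x = y + lat m n"
    using assms unfolding neighbours_def by blast
  have "(m, n) \<noteq> (0, 0)" using assms unfolding neighbours_def lat_def by auto
  moreover have "y - x = lat (- m) (- n)" unfolding xy(3) lat_minus[symmetric] by simp
  ultimately show ?thesis using neighbourI[of y x "- m" "- n"] xy by auto
qed

lemma lattice_point_neighbour: "lat (-1) (-1 - b) \<in> neighbours a b \<alpha>"
  using neighbourI[OF lattice_point_in_rauzy_fractal zero_in_rauzy_fractal lat_diff] by simp

lemma alpha_neighbour: "lat 0 1 \<in> neighbours a b \<alpha>"
proof -
  \<comment> \<open>\<open>e\<close> is the expansion of u = -1 - (1+b)\<alpha> shifted by one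
    place, with value \<alpha> u = -\<alpha> - (1+b)\<alpha>^2; the single digit of \<open>d\<close>
    cancels the square.\<close>
  define d where "d i = (if i = (2::nat) then - b - 1 else 0)" for i
  define e where "e i = (if i = (2::nat) then 0 else if i = 3 then a + b + 1 else a + b)" for i
  have adm: "admissible_inf a b d" "admissible_inf a b e"
    using hb1 hb2 by (auto simp: admissible_inf_def d_def e_def split: if_splits intro!: blocks_okI)
  have d: "expansion d = of_int (- b - 1) * \<alpha> ^ 2"
    using expansion_const_tail[OF adm(1), of 1 0] by (simp add: d_def eval_nat_numeral)
  have e: "expansion e = of_int (a + b + 1) * \<alpha> ^ 3 + \<alpha> ^ 3 * (of_int (a + b) * \<alpha> / (1 - \<alpha>))"
    using expansion_const_tail[OF adm(2), of 2 "a + b"] by (simp add: e_def eval_nat_numeral algebra_simps)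
  have "expansion d - expansion e = lat 0 1"
    unfolding d e geometric_tail_eq
    unfolding lat_def of_int_add of_int_diff of_int_minus of_int_0 of_int_1 of_int_numeral
    using alpha_cube by algebra
  then show ?thesis by (intro neighbourI[OF expansion_in_rauzy_fractal[OF adm(1)] expansion_in_rauzy_fractal[OF adm(2)]]) auto
qed

lemma third_neighbour: "lat (-1) (- b) \<in> neighbours a b \<alpha>"
proof -
  \<comment> \<open>Now the expansion of u is shifted by two places. Subtracting \<alpha>^2 u from
    \<open>d\<close> leaves a \<alpha>^2 - \<alpha>^3, which is -1 - b\<alpha> by the cubic.\<close>
  define d where "d i = (if i = (2::nat) then a - 1 else if i = 3 then - b - 2 else 0)" for i
  define e where "e i = (if i = (2::nat) \<or> i = 3 then 0 else if i = 4 then a + b + 1 else a + b)" for i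
  have adm: "admissible_inf a b d" "admissible_inf a b e"
    using hb1 hb2 by (auto simp: admissible_inf_def d_def e_def split: if_splits intro!: blocks_okI)
  have d: "expansion d = of_int (a - 1) * \<alpha> ^ 2 + of_int (- b - 2) * \<alpha> ^ 3"
    using expansion_const_tail[OF adm(1), of 2 0] by (simp add: d_def eval_nat_numeral)
  have e: "expansion e = of_int (a + b + 1) * \<alpha> ^ 4 + \<alpha> ^ 4 * (of_int (a + b) * \<alpha> / (1 - \<alpha>))"
    using expansion_const_tail[OF adm(2), of 3 "a + b"] by (simp add: e_def eval_nat_numeral algebra_simps)
  have "expansion d - expansion e = lat (-1) (- b)"
    unfolding d e geometric_tail_eq
    unfolding lat_def of_int_add of_int_diff of_int_minus of_int_0 of_int_1 of_int_numeral
    using alpha_cube by algebra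
  then show ?thesis by (intro neighbourI[OF expansion_in_rauzy_fractal[OF adm(1)] expansion_in_rauzy_fractal[OF adm(2)]]) auto
qed

section \<open>From \<open>T\<close>-representations to points of the fractal\<close>

lemma T_power:
  "\<alpha> ^ (j + 2) = of_int (T a b j) * \<alpha> ^ 2 + of_int (if 1 \<le> j then T a b (j - 1) else 0) * (1 + of_int b * \<alpha>)
     + of_int (if 2 \<le> j then T a b (j - 2) else 0) * \<alpha>"
proof -
  \<comment> \<open>In the basis \<alpha>^2, 1 + b\<alpha>, \<alpha>, multiplication by \<alpha>
    acts on coordinates exactly as the recurrence for T. The conditionals in the statement amount to
    T_(-1) = T_(-2) = 0.\<close>
  have step: "\<alpha> ^ (n + 4) = of_int (T a b (n + 2)) * \<alpha> ^ 2 + of_int (T a b (n + 1)) * (1 + of_int b * \<alpha>)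
     + of_int (T a b n) * \<alpha>" for n
  proof (induction n)
    case 0
    have "\<alpha> ^ 4 = (of_int a ^ 2 + of_int b) * \<alpha> ^ 2 + of_int a * (1 + of_int b * \<alpha>) + \<alpha>"
      using alpha_cube by algebra
    then show ?case by (simp add: numeral_2_eq_2 power2_eq_square)
  next
    case (Suc n)
    define x y z where "x = complex_of_int (T a b (n + 2))" and "y = complex_of_int (T a b (n + 1))"
      and "z = complex_of_int (T a b n)"
    have "\<alpha> ^ (Suc n + 4) = \<alpha> * \<alpha> ^ (n + 4)" unfolding add_Suc power_Suc ..
    also have "\<dots> = \<alpha> * (x * \<alpha> ^ 2 + y * (1 + of_int b * \<alpha>) + z * \<alpha>)"
      unfolding Suc x_def y_def z_def by simp
    also have "\<dots> = (of_int a * x + of_int b * y + z) * \<alpha> ^ 2 + x * (1 + of_int b * \<alpha>) + y * \<alpha>"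
      using alpha_cube by algebra
    finally show ?case by (simp add: x_def y_def z_def)
  qed
  consider "j = 0" | "j = 1" | n where "j = n + 2"
    using le_Suc_ex[of 2 j] by (cases "j < 2") (auto simp: less_2_cases_iff add.commute)
  then show ?thesis
  proof cases
    case 2
    then show ?thesis using alpha_cube by (simp add: numeral_3_eq_3 algebra_simps)
  next
    case 3
    then show ?thesis using step[of n] by (simp add: eval_nat_numeral)
  qed (simp add: power2_eq_square)
qed

text \<open>The point is the sum of d_j \<alpha>^(j+2), regrouped with \<open>T_power\<close>; its
  last two coefficients are the integer sums occurring in \<open>delta\<close>.\<close>

lemma Trep_point_in:
  assumes "is_Trep a b q d"
  shows "of_int q * \<alpha> ^ 2 + of_int (\<Sum>j\<in>{j. 1 \<le> j \<and> d j \<noteq> 0}. d j * T a b (j - 1)) * (1 + of_int b * \<alpha>)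
     + of_int (\<Sum>j\<in>{j. 2 \<le> j \<and> d j \<noteq> 0}. d j * T a b (j - 2)) * \<alpha> \<in> rauzy_fractal a b \<alpha>"
proof -
  obtain k where k: "\<And>N. k < N \<Longrightarrow> q = (\<Sum>j<N. d j * T a b j)" "\<And>j. j > k \<Longrightarrow> d j = 0"
    using is_Trep_sum[OF assms] by blast
  define N where "N = Suc k"
  have N: "d j = 0" if "N \<le> j" for j using k(2) that by (simp add: N_def)
  have sum_eq: "(\<Sum>j\<in>{j. p \<le> j \<and> d j \<noteq> 0}. d j * T a b (j - p))
      = (\<Sum>j<N. d j * (if p \<le> j then T a b (j - p) else 0))" for p
    by (rule sum.mono_neutral_cong_left) (auto simp: N not_less[symmetric] intro: ccontr)
  \<comment> \<open>Digit j moves to exponent j + 2. Truncated subtraction makes \<open>e 0\<close>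
    and \<open>e 1\<close> copies of \<open>d 0\<close>, but neither admissibility nor the expansion
    reads indices below 2.\<close>
  define e where "e i = d (i - 2)" for i
  have adm: "admissible_inf a b e"
    unfolding admissible_inf_def
  proof (intro conjI allI impI)
    show "blocks_ok a b 2 e"
      unfolding blocks_ok_iff
    proof (intro allI impI)
      fix j m :: nat
      assume jm: "2 + m \<le> j" and eq: "\<forall>i<m. e (j - i) = wmax a b i"
      have "j - i - 2 = j - 2 - i" for i by simp
      then show "e (j - m) \<le> wmax a b m"
        using blocks_okD[of a b 0 d m "j - 2"] assms jm eq by (simp add: e_def is_Trep_def)
    qed
  qed (use assms in \<open>auto simp: e_def is_Trep_def\<close>)
  have "expansion e = (\<Sum>j<N. of_int (d j) * \<alpha> ^ (j + 2))"
    using expansion_const_tail[OF adm, of N 0] N by (simp add: e_def)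
  also have "\<dots> = (\<Sum>j<N. of_int (d j * T a b j) * \<alpha> ^ 2
      + of_int (d j * (if 1 \<le> j then T a b (j - 1) else 0)) * (1 + of_int b * \<alpha>)
      + of_int (d j * (if 2 \<le> j then T a b (j - 2) else 0)) * \<alpha>)"
    by (rule sum.cong[OF refl], subst T_power) (simp only: of_int_mult distrib_left mult.assoc)
  also have "\<dots> = of_int (\<Sum>j<N. d j * T a b j) * \<alpha> ^ 2
      + of_int (\<Sum>j<N. d j * (if 1 \<le> j then T a b (j - 1) else 0)) * (1 + of_int b * \<alpha>)
      + of_int (\<Sum>j<N. d j * (if 2 \<le> j then T a b (j - 2) else 0)) * \<alpha>"
    unfolding of_int_sum sum_distrib_right sum.distrib ..
  finally show ?thesis
    using expansion_in_rauzy_fractal[OF adm] k(1)[of N] unfolding sum_eq by (simp add: N_def)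
qed

end

section \<open>Exactly six neighbours: the lattice points of the fractal\<close>

locale rauzy_six = rauzy +
  assumes hsix: "card (neighbours a b \<alpha>) = 6"
begin

definition six_vectors :: "(int \<times> int) set" where
  "six_vectors = {(-1, -1 - b), (1, 1 + b), (0, 1), (0, -1), (-1, - b), (1, b)}"

lemma neighbours_eq: "neighbours a b \<alpha> = (\<lambda>(m, n). lat m n) ` six_vectors"
proof -
  have fin: "finite (neighbours a b \<alpha>)" using hsix by (intro card_ge_0_finite) simp
  have "(\<lambda>(m, n). lat m n) ` six_vectors \<subseteq> neighbours a b \<alpha>"
    using lattice_point_neighbour alpha_neighbour third_neighbour neighbours_minus[OF lattice_point_neighbour]
      neighbours_minus[OF alpha_neighbour] neighbours_minus[OF third_neighbour]
    by (auto simp: six_vectors_def add.commute)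
  moreover have "inj_on (\<lambda>(m, n). lat m n) six_vectors" by (auto simp: inj_on_def lat_eq_iff)
  then have "card ((\<lambda>(m, n). lat m n) ` six_vectors) = card six_vectors" by (rule card_image)
  then have "card ((\<lambda>(m, n). lat m n) ` six_vectors) = card (neighbours a b \<alpha>)"
    unfolding hsix by (simp add: six_vectors_def)
  ultimately show ?thesis using card_subset_eq[OF fin] by metis
qed

lemma diff_in_six_vectors:
  assumes "x \<in> rauzy_fractal a b \<alpha>" "y \<in> rauzy_fractal a b \<alpha>" "x - y = lat m n"
  shows "(m, n) \<in> insert (0, 0) six_vectors"
proof (cases "(m, n) = (0, 0)")
  case False
  then have "lat m n \<in> (\<lambda>(m, n). lat m n) ` six_vectors"
    using neighbourI[OF assms] neighbours_eq by simp
  then show ?thesis by (auto simp: lat_eq_iff)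
qed simp

text \<open>Both 0 and u lie in the fractal, so x - 0 and u - x must each be zero or one of the six
  vectors.\<close>

lemma lattice_point_cases:
  assumes "lat m n \<in> rauzy_fractal a b \<alpha>"
  shows "(m, n) \<in> {(0, 0), (-1, -1 - b), (0, -1), (-1, - b)}"
proof -
  have "(m, n) \<in> insert (0, 0) six_vectors"
    using diff_in_six_vectors[OF assms zero_in_rauzy_fractal lat_diff] by simp
  moreover have "(- 1 - m, - 1 - b - n) \<in> insert (0, 0) six_vectors"
    using diff_in_six_vectors[OF lattice_point_in_rauzy_fractal assms lat_diff] .
  ultimately show ?thesis unfolding six_vectors_def by auto
qed

lemma lattice_points:
  assumes "lat m n \<in> rauzy_fractal a b \<alpha>"
  shows "(m, n) = (0, 0) \<or> (m, n) = (-1, -1 - b)"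
proof -
  have "(m, n) \<noteq> (0, -1)"
  proof
    assume mn: "(m, n) = (0, -1)"
    obtain d y where y: "0 \<le> d" "y \<in> rauzy_fractal a b \<alpha>" "lat m n = of_int d * \<alpha> ^ 2 + \<alpha> * y"
      using rauzy_fractal_shift[OF assms] by blast
    have "\<alpha> * y = \<alpha> * lat (-1) (- d)"
      using y(3) mn by (simp add: lat_def algebra_simps power2_eq_square)
    then have "y = lat (-1) (- d)" using alpha_nonzero by simp
    \<comment> \<open>Possible lattice points with first coordinate -1 have second coordinate -1 - b
      or -b, both positive, whereas -d is not.\<close>
    then show False using lattice_point_cases[of "-1" "- d"] y(1,2) hb2 by auto
  qed
  moreover have "(m, n) \<noteq> (-1, - b)"
  proof
    assume mn: "(m, n) = (-1, - b)"
    obtain d y where y: "d \<le> a - 1" "y \<in> rauzy_fractal a b \<alpha>" "lat m n = of_int d * \<alpha> ^ 2 + \<alpha> * y"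
      using rauzy_fractal_shift[OF assms] by blast
    obtain e z where z: "z \<in> rauzy_fractal a b \<alpha>" "y = of_int e * \<alpha> ^ 2 + \<alpha> * z"
      using rauzy_fractal_shift[OF y(2)] by blast
    have "- 1 - of_int b * \<alpha> = of_int d * \<alpha> ^ 2 + \<alpha> * y"
      using y(3) mn by (simp add: lat_def)
    \<comment> \<open>Here -1 - b\<alpha> is rewritten as a \<alpha>^2 - \<alpha>^3, so two digits
      can be stripped. The resulting first coordinate a - d is at least 1, but no possible lattice
      point has a positive one.\<close>
    then have "\<alpha> ^ 2 * z = \<alpha> ^ 2 * (of_int a - of_int d + (- 1 - of_int e) * \<alpha>)"
      using z(2) alpha_cube by algebra
    then have "z = lat (a - d) (- 1 - e)" using alpha_nonzero by (simp add: lat_def)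
    then show False using lattice_point_cases[of "a - d" "- 1 - e"] y(1) z(1) by auto
  qed
  ultimately show ?thesis using lattice_point_cases[OF assms] by blast
qed

end

theorem theorem3p1:
  fixes a b :: int and \<beta> :: real and \<alpha> :: complex
  assumes hb1: "- a + 1 \<le> b" and hb2: "b \<le> -2"
    and hbeta: "\<beta> ^ 3 - of_int a * \<beta> ^ 2 - of_int b * \<beta> - 1 = 0"
    and hdom: "\<forall>z::complex. z ^ 3 - of_int a * z ^ 2 - of_int b * z - 1 = 0
                 \<longrightarrow> z \<noteq> complex_of_real \<beta> \<longrightarrow> cmod z < \<beta>"
    and halpha: "\<alpha> ^ 3 - of_int a * \<alpha> ^ 2 - of_int b * \<alpha> - 1 = 0"
    and hnonreal: "Im \<alpha> \<noteq> 0"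
    and hsix: "card (neighbours a b \<alpha>) = 6"
  shows "\<exists>c>0. \<forall>q::int. \<forall>g1 g2 :: int. q > 0 \<longrightarrow>
           rauzy_norm b \<beta> \<alpha> (real_of_int q / \<beta> - real_of_int g1,
                               real_of_int q / \<beta> ^ 2 - real_of_int g2) < c \<longrightarrow>
           (real_of_int q / \<beta> - real_of_int g1, real_of_int q / \<beta> ^ 2 - real_of_int g2)
              = delta a b \<beta> q
         \<or> (real_of_int q / \<beta> - real_of_int g1, real_of_int q / \<beta> ^ 2 - real_of_int g2)
              = (fst (delta a b \<beta> q) - 1, snd (delta a b \<beta> q) - 1)"
proof -
  have "\<alpha> \<noteq> complex_of_real \<beta>" using hnonreal by auto
  then have "cmod \<alpha> < \<beta>" using hdom halpha by blast
  then interpret rauzy_six a b \<beta> \<alpha>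
    using hb1 hb2 hbeta halpha hnonreal hsix by unfold_locales
  define R where "R = rauzy_fractal a b \<alpha>"
  \<comment> \<open>A compact set has positive distance r from a disjoint closed set: a lattice
    point closer than r to the fractal must belong to it. Rescaling r by \<beta> |\<alpha>| gives
    c.\<close>
  have "compact R" "closed (tiling_lattice \<alpha> - R)" "R \<inter> (tiling_lattice \<alpha> - R) = {}"
    using compact_rauzy_fractal closed_lattice_subset[OF hnonreal] by (auto simp: R_def)
  then obtain r where r: "0 < r" "\<And>x y. x \<in> R \<Longrightarrow> y \<in> tiling_lattice \<alpha> - R \<Longrightarrow> r \<le> dist x y"
    using separate_compact_closed[of R "tiling_lattice \<alpha> - R"] by blast
  define c where "c = r / (\<beta> * cmod \<alpha>)"
  have pos: "0 < \<beta> * cmod \<alpha>" using beta_pos alpha_nonzero by simp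
  show ?thesis
  proof (intro exI[of _ c] conjI allI impI)
    show "0 < c" using r(1) pos by (simp add: c_def)
    fix q g1 g2 :: int
    assume q: "q > 0" and small: "rauzy_norm b \<beta> \<alpha> (real_of_int q / \<beta> - real_of_int g1,
        real_of_int q / \<beta> ^ 2 - real_of_int g2) < c"
    define d where "d = Trep a b q"
    define p1 where "p1 = (\<Sum>j\<in>{j. 1 \<le> j \<and> d j \<noteq> 0}. d j * T a b (j - 1))"
    define p2 where "p2 = (\<Sum>j\<in>{j. 2 \<le> j \<and> d j \<noteq> 0}. d j * T a b (j - 2))"
    have delta: "delta a b \<beta> q = (real_of_int q / \<beta> - real_of_int p1, real_of_int q / \<beta> ^ 2 - real_of_int p2)"
      unfolding delta_def Let_def p1_def p2_def d_def ..
    define x where "x = of_int q * \<alpha> ^ 2 + of_int p1 * (1 + of_int b * \<alpha>) + of_int p2 * \<alpha>"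
    have x: "x \<in> R"
      unfolding R_def x_def p1_def p2_def using Trep_is_Trep[OF q] by (intro Trep_point_in) (simp add: d_def)
    \<comment> \<open>Coordinates of (p1 - g1)(1 + b\<alpha>) + (p2 - g2)\<alpha> in the basis 1,
      \<alpha>. The point u thus corresponds to p1 - g1 = p2 - g2 = -1, which is the shift by
      (1,1).\<close>
    define m n where "m = p1 - g1" and "n = (p2 - g2) + b * (p1 - g1)"
    have "cmod (x - lat m n) = \<beta> * cmod \<alpha> *
        rauzy_norm b \<beta> \<alpha> (real_of_int q / \<beta> - real_of_int g1, real_of_int q / \<beta> ^ 2 - real_of_int g2)"
      unfolding rauzy_norm_eq by (rule arg_cong[of _ _ cmod]) (simp add: x_def lat_def m_def n_def algebra_simps)
    also have "\<dots> < r" using small pos by (simp add: c_def field_simps)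
    finally have "dist x (lat m n) < r" by (simp add: dist_norm)
    then have "lat m n \<in> rauzy_fractal a b \<alpha>"
      using r(2)[OF x, of "lat m n"] lat_in_lattice by (force simp: R_def)
    then consider "m = 0" "n = 0" | "m = -1" "n = -1 - b" using lattice_points by blast
    then show "(real_of_int q / \<beta> - real_of_int g1, real_of_int q / \<beta> ^ 2 - real_of_int g2)
              = delta a b \<beta> q
         \<or> (real_of_int q / \<beta> - real_of_int g1, real_of_int q / \<beta> ^ 2 - real_of_int g2)
              = (fst (delta a b \<beta> q) - 1, snd (delta a b \<beta> q) - 1)"
    proof cases
      case 1
      then have "g1 = p1" "g2 = p2" by (auto simp: m_def n_def)
      then show ?thesis by (simp add: delta)
    next
      case 2
      then have "g1 = p1 + 1" "p2 - g2 = -1 - b + b" by (auto simp: m_def n_def)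
      then have "g1 = p1 + 1" "g2 = p2 + 1" by auto
      then show ?thesis by (simp add: delta)
    qed
  qed
qed

end
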